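(* Suppose $A,B\subseteq\mathbb{N}$ form a solution to the degree-$k$ Prouhet–Tarry–Escott (PTE) system, and let $n=\max(A\cup B)$. Define strings $\mathbf{x},\mathbf{y}\in\{0,1\}^{n+1}$ by, for all $i\in\{0,1,\dots,n\}$, $$x_i=\begin{cases}0& \text{if } i\notin A\\ 1& \text{if } i\in A\end{cases},\qquad y_i=\begin{cases}0& \text{if } i\notin B\\ 1& \text{if } i\in B\end{cases}.$$ Then for any $\varepsilon>0$, $n^{\Omega(k)}$ traces are necessary for mean-based algorithms to distinguish between $0^{\ell}\mathbf{x}$ and $0^{\ell}\mathbf{y}$, where $\ell=n^{3+\varepsilon}$.
   Context: Sets $A=\{\alpha_1,\dots,\alpha_s\}$ and $B=\{\beta_1,\dots,\beta_s\}$ of integers form a solution to the degree-$k$ PTE system if $\sum_{i=1}^s\alpha_i^j=\sum_{i=1}^s\beta_i^j$ for all $j\in\{1,\dots,k\}$, with $\alpha_i\neq\beta_j$ for all $i,j\in\{1,\dots,s\}$. The string $0^\ell\mathbf{x}$ is $\mathbf{x}$ preceded by $\ell$ zeros. Strings are indexed from $0$. A trace $\tilde{\mathbf{u}}$ of $\mathbf{u}\in\{0,1\}^N$ is the random subsequence obtained by deleting each bit of $\mathbf{u}$ independently with probability $p$, where the deletion probability $p\in(0,1)$ is a constant, with the convention $\tilde u_j=0$ for $j>|\tilde{\mathbf{u}}|-1$. For $j=0,\dots,N-1$ let $E_j(\mathbf{u})=\mathbb{E}[\tilde u_j]$. Distinguishing $\mathbf{u}$ and $\mathbf{v}$ in $\{0,1\}^N$: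 given the strings $\mathbf{u},\mathbf{v}$ and a set $S$ of independent traces of one of them, the algorithm must output, with probability at least $2/3$, which string is the source. An algorithm is mean-based if its output depends only on the statistical estimates of the means $E_j$, $j=0,\dots,N-1$, of the source; that is, it disregards the actual samples and uses only the empirical averages $\mathbb{E}_S[\tilde u_j]$ of each bit over the sample set $S$ of independent traces. The number of traces is $|S|$. The notation $\Omega(k)$ is asymptotic; the implied constant may depend on the constants $p$ and $\varepsilon$.
   Formalization: Mean-based is made precise: success probability 2/3 is required for every law on strings of length at most the source's with the same bit means, not only for the trace law; with arbitrary functions of the empirical averages of traces the claim fails (scale a fixed PTE solution). *)

theory Defs
  imports "HOL-Probability.Probability"
begin

definition pte_solution :: "nat \<Rightarrow> int set \<Rightarrow> int set \<Rightarrow> bool" where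
  "pte_solution k A B \<longleftrightarrow>
     finite A \<and> finite B \<and> A \<noteq> {} \<and> card A = card B \<and> A \<inter> B = {} \<and>
     (\<forall>j\<in>{1..k}. (\<Sum>a\<in>A. a ^ j) = (\<Sum>b\<in>B. b ^ j))"

definition indicator_string :: "nat \<Rightarrow> nat set \<Rightarrow> bool list" where
  "indicator_string n A = map (\<lambda>i. i \<in> A) [0..<n + 1]"

definition zeros :: "nat \<Rightarrow> bool list" where
  "zeros l = replicate l False"

text \<open>Deletion channel; \<^term>\<open>p\<close> is the deletion probability.\<close>

primrec deletion_trace :: "real \<Rightarrow> bool list \<Rightarrow> bool list pmf" where
  "deletion_trace p [] = return_pmf []"
| "deletion_trace p (b # u) =
     bind_pmf (bernoulli_pmf p) (\<lambda>deleted.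
       map_pmf (\<lambda>w. if deleted then w else b # w) (deletion_trace p u))"

text \<open>Strings are padded with zeros on the right.\<close>

definition bit_at :: "bool list \<Rightarrow> nat \<Rightarrow> real" where
  "bit_at w j = (if j < length w \<and> w ! j then 1 else 0)"

definition mean_bit :: "bool list pmf \<Rightarrow> nat \<Rightarrow> real" where
  "mean_bit D j = measure_pmf.expectation D (\<lambda>w. bit_at w j)"

definition same_means :: "bool list pmf \<Rightarrow> bool list pmf \<Rightarrow> nat \<Rightarrow> bool" where
  "same_means D E N \<longleftrightarrow>
     (\<forall>w\<in>set_pmf D. length w \<le> N) \<and> (\<forall>j<N. mean_bit D j = mean_bit E j)"

definition empirical_means :: "nat \<Rightarrow> bool list list \<Rightarrow> real list" where
  "empirical_means N S =
     map (\<lambda>j. (\<Sum>w\<leftarrow>S. bit_at w j) / real (length S)) [0..<N]"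

text \<open>Probability that the (possibly randomized) decision rule \<^term>\<open>f\<close>, given only the
  empirical means of \<^term>\<open>T\<close> independent samples from \<^term>\<open>D\<close>, outputs \<^term>\<open>b\<close>.\<close>

definition output_prob ::
    "nat \<Rightarrow> nat \<Rightarrow> (real list \<Rightarrow> bool pmf) \<Rightarrow> bool list pmf \<Rightarrow> bool \<Rightarrow> real" where
  "output_prob N T f D b =
     pmf (bind_pmf (replicate_pmf T D) (\<lambda>S. f (empirical_means N S))) b"

text \<open>
  Output \<^term>\<open>True\<close> stands for the source \<^term>\<open>u\<close>, \<^term>\<open>False\<close> for \<^term>\<open>v\<close>.
  A mean-based algorithm uses nothing about the source but its means. Letting \<^term>\<open>f\<close> be a
  function of the vector of empirical means does not by itself enforce this: the joint law of
  that vector also reflects correlations between the bits of a single trace, and if a few traces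
  have their ones in disjoint places, the vector even displays the traces side by side.
  Correctness is therefore required to rest on the means alone, that is, for every law
  \<^term>\<open>D\<close> of strings of at most the source length that has the means of the source; the
  laws \<^term>\<open>deletion_trace p u\<close> and \<^term>\<open>deletion_trace p v\<close> are instances, by the
  lemma at the end.
\<close>

definition mean_based_distinguishes ::
    "real \<Rightarrow> nat \<Rightarrow> (real list \<Rightarrow> bool pmf) \<Rightarrow> bool list \<Rightarrow> bool list \<Rightarrow> bool" where
  "mean_based_distinguishes p T f u v \<longleftrightarrow>
     length u = length v \<and>
     (\<forall>D. same_means D (deletion_trace p u) (length u) \<longrightarrow>
        output_prob (length u) T f D True \<ge> 2 / 3) \<and>
     (\<forall>D. same_means D (deletion_trace p v) (length v) \<longrightarrow>
        output_prob (length v) T f D False \<ge> 2 / 3)"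

lemma length_deletion_trace: "w \<in> set_pmf (deletion_trace p u) \<Longrightarrow> length w \<le> length u"
  by (induction u arbitrary: w) (fastforce split: if_splits)+

lemma mean_based_distinguishes_traces:
  assumes "mean_based_distinguishes p T f u v"
  shows "output_prob (length u) T f (deletion_trace p u) True \<ge> 2 / 3"
    and "output_prob (length v) T f (deletion_trace p v) False \<ge> 2 / 3"
  using assms length_deletion_trace
  unfolding mean_based_distinguishes_def same_means_def by blast+

end

theory Submission
  imports Defs
begin

text \<open>
  A law with independent bits of the prescribed means is admissible, so the sample count must make
  up for the \<open>\<ell>\<^sub>1\<close>-distance of the two mean vectors. With \<open>q = 1 - p\<close>, the generating polynomial
  of the means of \<open>0\<^sup>l u\<close> is \<open>q (p + q z)\<^sup>l U(p + q z)\<close>, where \<open>U(w) = \<Sum>\<^sub>i u\<^sub>i w\<^sup>i\<close>. A PTE solution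
  of degree \<open>k\<close> gives \<open>A(w) - B(w) = (w - 1)\<^sup>m R(w)\<close> with \<open>m = k + 1\<close>, and dividing by \<open>w - 1\<close>
  multiplies the \<open>\<ell>\<^sub>1\<close>-norm by at most \<open>n\<close>. Since \<open>p + q z - 1 = q (z - 1)\<close>, the factor
  \<open>(p + q z)\<^sup>l\<close> can be split into \<open>m\<close> equal blocks, each absorbing one factor \<open>z - 1\<close>; the
  \<open>\<ell>\<^sub>1\<close>-norm of \<open>(p + q z)\<^sup>L (z - 1)\<close> is of order \<open>1 / sqrt L\<close>. Each of the \<open>m \<le> n\<close> factors thus
  contributes \<open>O(n sqrt (m / l)) = O(n powr (-\<epsilon>/2))\<close>.
\<close>

subsection \<open>Sample bounds from total variation\<close>

lemma expectation_bind_pmf: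
  fixes h :: "'b \<Rightarrow> real"
  assumes "\<And>y. \<bar>h y\<bar> \<le> B"
  shows "measure_pmf.expectation (bind_pmf M F) h =
    measure_pmf.expectation M (\<lambda>x. measure_pmf.expectation (F x) h)"
  unfolding measure_pmf_bind
  by (rule integral_bind[where K = "count_space UNIV" and B' = 1 and B = B])
    (use assms in \<open>auto simp: measure_pmf_in_subprob_algebra intro!: AE_I2\<close>)

text \<open>Testing against all [0,1]-valued functions makes composition easy: the conditional
  expectation of a test function is again a test function.\<close>

definition tv_dist_le :: "real \<Rightarrow> 'a pmf \<Rightarrow> 'a pmf \<Rightarrow> bool" where
  "tv_dist_le d P Q \<longleftrightarrow> (\<forall>h::'a \<Rightarrow> real. (\<forall>x. 0 \<le> h x \<and> h x \<le> 1) \<longrightarrow>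
     \<bar>measure_pmf.expectation P h - measure_pmf.expectation Q h\<bar> \<le> d)"

lemma tv_dist_le_refl: "tv_dist_le 0 P P"
  by (simp add: tv_dist_le_def)

lemma integrable_pmf_bounded:
  fixes h :: "'a \<Rightarrow> real"
  assumes "\<And>x. 0 \<le> h x \<and> h x \<le> 1"
  shows "integrable (measure_pmf P) h"
  by (rule measure_pmf.integrable_const_bound[where B = 1]) (use assms in auto)

lemma expectation_pmf_unit:
  fixes h :: "'a \<Rightarrow> real"
  assumes "\<And>x. 0 \<le> h x \<and> h x \<le> 1"
  shows "0 \<le> measure_pmf.expectation P h \<and> measure_pmf.expectation P h \<le> 1"
proof
  show "0 \<le> measure_pmf.expectation P h"
    by (rule integral_nonneg_AE) (use assms in auto)
  show "measure_pmf.expectation P h \<le> 1"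
    by (rule measure_pmf.integral_le_const[OF integrable_pmf_bounded]) (use assms in auto)
qed

text \<open>Hybrid argument through \<open>bind_pmf Q F\<close>: first \<open>P\<close> is replaced
  by \<open>Q\<close>, tested against the conditional expectation \<open>f\<close>; then
  \<open>F x\<close> is replaced by \<open>G x\<close>, which moves the integrand by at most
  \<open>e\<close> everywhere.\<close>

lemma tv_dist_le_bind:
  assumes PQ: "tv_dist_le d P Q" and FG: "\<And>x. tv_dist_le e (F x) (G x)"
  shows "tv_dist_le (d + e) (bind_pmf P F) (bind_pmf Q G)"
  unfolding tv_dist_le_def
proof (intro allI impI)
  fix h :: "'b \<Rightarrow> real" assume h: "\<forall>x. 0 \<le> h x \<and> h x \<le> 1"
  define f where "f = (\<lambda>x. measure_pmf.expectation (F x) h)"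
  define g where "g = (\<lambda>x. measure_pmf.expectation (G x) h)"
  have f: "0 \<le> f x \<and> f x \<le> 1" and g: "0 \<le> g x \<and> g x \<le> 1" for x
    unfolding f_def g_def by (rule expectation_pmf_unit, use h in blast)+
  have fg: "\<bar>f x - g x\<bar> \<le> e" for x
    using FG[of x] h by (auto simp: tv_dist_le_def f_def g_def)
  have int: "integrable (measure_pmf M) f" "integrable (measure_pmf M) g" for M
    using f g by (auto intro: integrable_pmf_bounded)
  have "measure_pmf.expectation (bind_pmf P F) h = measure_pmf.expectation P f"
    unfolding f_def by (rule expectation_bind_pmf[where B = 1]) (use h in auto)
  moreover have "measure_pmf.expectation (bind_pmf Q G) h = measure_pmf.expectation Q g"
    unfolding g_def by (rule expectation_bind_pmf[where B = 1]) (use h in auto)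
  moreover have "\<bar>measure_pmf.expectation P f - measure_pmf.expectation Q f\<bar> \<le> d"
    using PQ f by (auto simp: tv_dist_le_def)
  moreover have "\<bar>measure_pmf.expectation Q f - measure_pmf.expectation Q g\<bar> \<le> e"
  proof -
    have "\<bar>measure_pmf.expectation Q f - measure_pmf.expectation Q g\<bar>
        = \<bar>measure_pmf.expectation Q (\<lambda>x. f x - g x)\<bar>"
      using int by simp
    also have "\<dots> \<le> measure_pmf.expectation Q (\<lambda>x. \<bar>f x - g x\<bar>)"
      by (rule integral_abs_bound)
    also have "\<dots> \<le> e"
      by (rule measure_pmf.integral_le_const) (use int fg in auto)
    finally show ?thesis .
  qed
  ultimately show "\<bar>measure_pmf.expectation (bind_pmf P F) h
      - measure_pmf.expectation (bind_pmf Q G) h\<bar> \<le> d + e"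
    by linarith
qed

lemma tv_dist_le_map: "tv_dist_le d P Q \<Longrightarrow> tv_dist_le d (map_pmf g P) (map_pmf g Q)"
  using tv_dist_le_bind[of d P Q 0 "\<lambda>x. return_pmf (g x)" "\<lambda>x. return_pmf (g x)"]
  by (simp add: map_pmf_def tv_dist_le_refl)

lemma tv_dist_le_replicate_pmf:
  assumes "tv_dist_le d P Q"
  shows "tv_dist_le (real T * d) (replicate_pmf T P) (replicate_pmf T Q)"
proof (induction T)
  case 0
  show ?case by (simp add: tv_dist_le_refl)
next
  case (Suc T)
  have "tv_dist_le (d + real T * d) (replicate_pmf (Suc T) P) (replicate_pmf (Suc T) Q)"
    unfolding replicate_pmf.simps map_pmf_def[symmetric]
    by (intro tv_dist_le_bind assms tv_dist_le_map Suc.IH)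
  then show ?case by (simp add: algebra_simps)
qed

lemma tv_dist_le_bernoulli:
  assumes "a \<in> {0..1}" "b \<in> {0..1}"
  shows "tv_dist_le \<bar>a - b\<bar> (bernoulli_pmf a) (bernoulli_pmf b)"
  unfolding tv_dist_le_def
proof (intro allI impI)
  fix h :: "bool \<Rightarrow> real" assume h: "\<forall>x. 0 \<le> h x \<and> h x \<le> 1"
  have "measure_pmf.expectation (bernoulli_pmf a) h - measure_pmf.expectation (bernoulli_pmf b) h
      = (a - b) * (h True - h False)"
    using assms by (simp add: algebra_simps)
  moreover have "\<bar>h True - h False\<bar> \<le> 1"
    using h by (smt (verit))
  ultimately show "\<bar>measure_pmf.expectation (bernoulli_pmf a) h
      - measure_pmf.expectation (bernoulli_pmf b) h\<bar> \<le> \<bar>a - b\<bar>"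
    by (simp add: abs_mult mult_left_le)
qed

lemma tv_dist_le_pmf:
  assumes "tv_dist_le d P Q"
  shows "\<bar>pmf P x - pmf Q x\<bar> \<le> d"
proof -
  have "measure_pmf.expectation R (indicator {x}) = pmf R x" for R :: "'a pmf"
    by (simp add: pmf.rep_eq)
  moreover have "\<bar>measure_pmf.expectation P (indicator {x})
      - measure_pmf.expectation Q (indicator {x})\<bar> \<le> d"
    by (rule assms[unfolded tv_dist_le_def, rule_format]) (simp add: indicator_def)
  ultimately show ?thesis by simp
qed

section \<open>Product laws with prescribed means\<close>

primrec independent_bits :: "real list \<Rightarrow> bool list pmf" where
  "independent_bits [] = return_pmf []"
| "independent_bits (a # as) =
     bind_pmf (bernoulli_pmf a) (\<lambda>b. map_pmf (Cons b) (independent_bits as))"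

lemma length_independent_bits: "w \<in> set_pmf (independent_bits as) \<Longrightarrow> length w = length as"
  by (induction as arbitrary: w) auto

lemma bit_at_simps [simp]:
  "bit_at [] j = 0"
  "bit_at (b # w) 0 = of_bool b"
  "bit_at (b # w) (Suc j) = bit_at w j"
  by (auto simp: bit_at_def)

lemma bit_at_unit: "0 \<le> bit_at w j \<and> bit_at w j \<le> 1"
  by (simp add: bit_at_def)

lemma mean_bit_unit: "mean_bit D j \<in> {0..1}"
  unfolding mean_bit_def using expectation_pmf_unit[of "\<lambda>w. bit_at w j" D] bit_at_unit by auto

lemma mean_bit_bind:
  "mean_bit (bind_pmf M F) j = measure_pmf.expectation M (\<lambda>x. mean_bit (F x) j)"
  unfolding mean_bit_def
  by (rule expectation_bind_pmf[where B = 1]) (simp add: bit_at_def)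

lemma mean_bit_map_Cons [simp]:
  "mean_bit (map_pmf (Cons b) D) 0 = of_bool b"
  "mean_bit (map_pmf (Cons b) D) (Suc j) = mean_bit D j"
  by (simp_all add: mean_bit_def)

lemma mean_bit_independent_bits:
  assumes "set as \<subseteq> {0..1}" "j < length as"
  shows "mean_bit (independent_bits as) j = as ! j"
  using assms
proof (induction as arbitrary: j)
  case (Cons a as)
  then show ?case by (cases j) (auto simp: mean_bit_bind)
qed simp

text \<open>The bits are drawn one after another without influence on the later ones, so the errors
  of the coordinates add up.\<close>

lemma tv_dist_le_independent_bits:
  assumes "length as = length bs" "set as \<subseteq> {0..1}" "set bs \<subseteq> {0..1}"
  shows "tv_dist_le (\<Sum>(a, b)\<leftarrow>zip as bs. \<bar>a - b\<bar>) (independent_bits as) (independent_bits bs)"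
  using assms
proof (induction as bs rule: list_induct2)
  case (Cons a as b bs)
  then show ?case
    by (auto intro!: tv_dist_le_bind tv_dist_le_bernoulli tv_dist_le_map)
qed (simp add: tv_dist_le_refl)

text \<open>Correctness is invoked at product laws instead of the trace laws: they have the means of
  the sources, and their total variation distance is at most the l1 distance of these means.\<close>

lemma mean_based_distinguishes_lower_bound:
  assumes dist: "mean_based_distinguishes p T f u v"
  shows "1 / 3 \<le> real T *
    (\<Sum>j<length u. \<bar>mean_bit (deletion_trace p u) j - mean_bit (deletion_trace p v) j\<bar>)"
proof -
  define N where "N = length u"
  have N: "length v = N" using dist by (simp add: mean_based_distinguishes_def N_def)
  define mu where "mu w = map (mean_bit (deletion_trace p w)) [0..<N]" for w
  define D where "D w = independent_bits (mu w)" for w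
  have mu: "set (mu w) \<subseteq> {0..1}" for w
    unfolding mu_def using mean_bit_unit by auto
  have same: "same_means (D w) (deletion_trace p w) N" for w
    unfolding same_means_def D_def
    using length_independent_bits[of _ "mu w"] mean_bit_independent_bits[OF mu[of w]]
    by (auto simp: mu_def)
  define d where
    "d = (\<Sum>j<N. \<bar>mean_bit (deletion_trace p u) j - mean_bit (deletion_trace p v) j\<bar>)"
  have "(\<Sum>(a, b)\<leftarrow>zip (mu u) (mu v). \<bar>a - b\<bar>) = d"
    unfolding d_def mu_def zip_map_map zip_same_conv_map
    by (simp add: comp_def sum_list_sum_nth atLeast0LessThan)
  then have "tv_dist_le d (D u) (D v)"
    using tv_dist_le_independent_bits[of "mu u" "mu v"] mu unfolding D_def by (simp add: mu_def)
  \<comment> \<open>The same kernel acts on both sides, so forming the averages and applying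
    \<open>f\<close> costs \<open>0\<close>.\<close>
  then have "tv_dist_le (real T * d + 0)
      (bind_pmf (replicate_pmf T (D u)) (\<lambda>S. f (empirical_means N S)))
      (bind_pmf (replicate_pmf T (D v)) (\<lambda>S. f (empirical_means N S)))"
    by (intro tv_dist_le_bind tv_dist_le_replicate_pmf tv_dist_le_refl)
  then have "\<bar>output_prob N T f (D u) True - output_prob N T f (D v) True\<bar> \<le> real T * d"
    unfolding output_prob_def using tv_dist_le_pmf by fastforce
  moreover have "output_prob N T f (D u) True \<ge> 2 / 3" "output_prob N T f (D v) False \<ge> 2 / 3"
    using dist same[of u] same[of v] N by (auto simp: mean_based_distinguishes_def N_def)
  \<comment> \<open>Complementing shows that \<open>True\<close> has probability at most 1/3 under
    \<open>D v\<close>, hence a gap of at least 1/3 to \<open>D u\<close>.\<close>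
  moreover have "output_prob N T f (D v) False = 1 - output_prob N T f (D v) True"
    unfolding output_prob_def by (rule pmf_False_conv_True)
  ultimately show ?thesis unfolding d_def N_def by linarith
qed

subsection \<open>The coefficient norm of polynomials\<close>

definition coeff_norm :: "real poly \<Rightarrow> real" where
  "coeff_norm P = (\<Sum>i\<le>degree P. \<bar>coeff P i\<bar>)"

text \<open>A freely chosen \<open>N\<close> above the degree lets polynomials of different degrees
  be summed over one range.\<close>

lemma coeff_norm_eq_sum_lessThan:
  assumes "degree P < N"
  shows "coeff_norm P = (\<Sum>i<N. \<bar>coeff P i\<bar>)"
  unfolding coeff_norm_def
  by (rule sum.mono_neutral_left) (use assms in \<open>auto simp: coeff_eq_0\<close>)

lemma sum_abs_coeff_le_coeff_norm: "(\<Sum>i<N. \<bar>coeff P i\<bar>) \<le> coeff_norm P"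
proof -
  have "(\<Sum>i<N. \<bar>coeff P i\<bar>) \<le> (\<Sum>i<N + Suc (degree P). \<bar>coeff P i\<bar>)"
    by (rule sum_mono2) auto
  then show ?thesis by (subst coeff_norm_eq_sum_lessThan[where N = "N + Suc (degree P)"]) auto
qed

lemma coeff_norm_nonneg: "0 \<le> coeff_norm P"
  by (simp add: coeff_norm_def sum_nonneg)

lemma coeff_norm_0 [simp]: "coeff_norm 0 = 0"
  by (simp add: coeff_norm_def)

lemma coeff_norm_pCons [simp]: "coeff_norm (pCons a P) = \<bar>a\<bar> + coeff_norm P"
proof -
  have "coeff_norm (pCons a P) = (\<Sum>i<Suc (Suc (degree P)). \<bar>coeff (pCons a P) i\<bar>)"
    by (rule coeff_norm_eq_sum_lessThan) (simp add: degree_pCons_eq_if)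
  also have "\<dots> = \<bar>a\<bar> + (\<Sum>i<Suc (degree P). \<bar>coeff P i\<bar>)"
    by (subst sum.lessThan_Suc_shift) simp
  finally show ?thesis by (subst (asm) coeff_norm_eq_sum_lessThan[symmetric]) auto
qed

lemma coeff_norm_add: "coeff_norm (P + Q) \<le> coeff_norm P + coeff_norm Q"
proof -
  define N where "N = Suc (max (degree P) (degree Q))"
  have "degree (P + Q) < N" "degree P < N" "degree Q < N"
    using degree_add_le_max[of P Q] by (auto simp: N_def)
  then show ?thesis
    by (simp add: coeff_norm_eq_sum_lessThan sum_mono abs_triangle_ineq flip: sum.distrib)
qed

lemma coeff_norm_smult [simp]: "coeff_norm (smult c P) = \<bar>c\<bar> * coeff_norm P"
  by (cases "c = 0") (simp_all add: coeff_norm_def abs_mult sum_distrib_left)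

text \<open>Multiplication by the variable only shifts coefficients, so the Horner recursion in
  \<open>P\<close> reduces the product to scalings and sums.\<close>

lemma coeff_norm_mult: "coeff_norm (P * Q) \<le> coeff_norm P * coeff_norm Q"
proof (induction P)
  case (pCons a P)
  have "coeff_norm (pCons a P * Q) \<le> coeff_norm (smult a Q) + coeff_norm (pCons 0 (P * Q))"
    unfolding mult_pCons_left by (rule coeff_norm_add)
  also have "\<dots> \<le> \<bar>a\<bar> * coeff_norm Q + coeff_norm P * coeff_norm Q"
    using pCons.IH by simp
  finally show ?case by (simp add: algebra_simps)
qed simp

lemma coeff_norm_power: "coeff_norm (P ^ n) \<le> coeff_norm P ^ n"
proof (induction n)
  case (Suc n)
  have "coeff_norm (P ^ Suc n) \<le> coeff_norm P * coeff_norm (P ^ n)"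
    using coeff_norm_mult[of P "P ^ n"] by simp
  also have "\<dots> \<le> coeff_norm P * coeff_norm P ^ n"
    by (rule mult_left_mono[OF Suc.IH coeff_norm_nonneg])
  finally show ?case by simp
qed (simp add: coeff_norm_def)

text \<open>Each Horner level multiplies by \<open>Q\<close>, which cannot increase the norm. The
  intended \<open>Q\<close> is \<open>[:p, q:]\<close>, whose norm is
  \<open>p + q = 1\<close>.\<close>

lemma coeff_norm_pcompose:
  assumes "coeff_norm Q \<le> 1"
  shows "coeff_norm (pcompose P Q) \<le> coeff_norm P"
proof (induction P)
  case (pCons a P)
  have "coeff_norm (pcompose (pCons a P) Q) \<le> \<bar>a\<bar> + coeff_norm (Q * pcompose P Q)"
    unfolding pcompose_pCons using coeff_norm_add[of "[:a:]" "Q * pcompose P Q"] by simp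
  also have "coeff_norm (Q * pcompose P Q) \<le> coeff_norm Q * coeff_norm (pcompose P Q)"
    by (rule coeff_norm_mult)
  also have "\<dots> \<le> 1 * coeff_norm P"
    by (rule mult_mono) (use assms pCons.IH coeff_norm_nonneg in auto)
  finally show ?case by simp
qed simp

lemma coeff_linear_factor_mult:
  fixes P :: "'a :: comm_ring_1 poly"
  shows "coeff ([:-1, 1:] * P) i = (if i = 0 then 0 else coeff P (i - 1)) - coeff P i"
  by (simp add: coeff_pCons split: nat.split)

text \<open>Up to sign, the coefficients of \<open>Q\<close> are partial sums of those of the
  product, so each is bounded by the norm of the product; a nonzero \<open>Q\<close> has at most
  \<open>n\<close> of them.\<close>

lemma coeff_norm_linear_factor:
  assumes "degree ([:-1, 1:] * Q) \<le> n"
  shows "coeff_norm Q \<le> real n * coeff_norm ([:-1, 1:] * Q)"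
proof (cases "Q = 0")
  case False
  define P where "P = [:-1, 1:] * Q"
  have P: "coeff P i = (if i = 0 then 0 else coeff Q (i - 1)) - coeff Q i" for i
    unfolding P_def by (rule coeff_linear_factor_mult)
  have partial: "\<bar>coeff Q i\<bar> \<le> (\<Sum>j<Suc i. \<bar>coeff P j\<bar>)" for i
  proof (induction i)
    case (Suc i)
    have "\<bar>coeff Q (Suc i)\<bar> \<le> \<bar>coeff Q i\<bar> + \<bar>coeff P (Suc i)\<bar>"
      using P[of "Suc i"] by simp
    then show ?case using Suc.IH by simp
  qed (simp add: P)
  have "degree ([:-1, 1:] * Q) = degree [:-1, 1::real:] + degree Q"
    by (rule degree_mult_eq) (use False in auto)
  then have deg: "Suc (degree Q) \<le> n"
    using assms by (simp del: mult_pCons_left)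
  have "coeff_norm Q \<le> (\<Sum>i\<le>degree Q. coeff_norm P)"
    unfolding coeff_norm_def[of Q]
    using order_trans[OF partial sum_abs_coeff_le_coeff_norm] by (intro sum_mono) blast
  also have "\<dots> = real (Suc (degree Q)) * coeff_norm P"
    by simp
  also have "\<dots> \<le> real n * coeff_norm P"
    using deg coeff_norm_nonneg by (intro mult_right_mono) simp_all
  finally show ?thesis unfolding P_def .
qed simp

lemma coeff_norm_linear_power_factor:
  assumes "degree ([:-1, 1:] ^ m * Q) \<le> n"
  shows "coeff_norm Q \<le> real n ^ m * coeff_norm ([:-1, 1:] ^ m * Q)"
  using assms
proof (induction m arbitrary: Q)
  case (Suc m)
  \<comment> \<open>The split lets the induction hypothesis treat \<open>[:-1, 1:] * Q\<close> as
    the quotient; its degree is still at most \<open>n\<close> because it divides the full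
    product.\<close>
  have eq: "[:-1, 1:] ^ Suc m * Q = [:-1, 1:] ^ m * ([:-1, 1:] * Q)"
    by (simp only: power_Suc2 mult.assoc)
  have "degree ([:-1, 1:] * Q) \<le> n"
  proof (cases "Q = 0")
    case False
    then have "degree ([:-1, 1:] * Q) \<le> degree ([:-1, 1:] ^ m * ([:-1, 1:] * Q))"
      by (intro dvd_imp_degree_le dvd_triv_right) (simp del: mult_pCons_left)
    then show ?thesis using Suc.prems eq by simp
  qed simp
  then have "coeff_norm Q \<le> real n * coeff_norm ([:-1, 1:] * Q)"
    by (rule coeff_norm_linear_factor)
  also have "\<dots> \<le> real n * (real n ^ m * coeff_norm ([:-1, 1:] ^ m * ([:-1, 1:] * Q)))"
    using Suc.prems eq by (intro mult_left_mono Suc.IH) simp_all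
  finally show ?case unfolding eq by (simp only: power_Suc mult.assoc)
qed simp

section \<open>Binomial powers and the smoothing of a difference\<close>

lemma coeff_binomial_power:
  "coeff ([:a, b:] ^ n) k = real (n choose k) * b ^ k * a ^ (n - k)"
proof (cases "k \<le> n")
  case True
  have "[:a, b:] = [:0, b:] + [:a:]" by simp
  then have "[:a, b:] ^ n = (\<Sum>i\<le>n. of_nat (n choose i) * [:0, b:] ^ i * [:a:] ^ (n - i))"
    by (simp only: binomial_ring)
  also have "\<dots> = (\<Sum>i\<le>n. monom (real (n choose i) * b ^ i * a ^ (n - i)) i)"
  proof (rule sum.cong[OF refl])
    fix i
    have "[:0, b:] ^ i = monom (b ^ i) i"
      by (metis monom_0 monom_Suc monom_power mult_1 One_nat_def)
    moreover have "[:a:] ^ (n - i) = [:a ^ (n - i):]"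
      by (simp add: poly_const_pow)
    ultimately show "of_nat (n choose i) * [:0, b:] ^ i * [:a:] ^ (n - i)
        = monom (real (n choose i) * b ^ i * a ^ (n - i)) i"
      by (simp add: of_nat_poly smult_monom mult_ac)
  qed
  also have "coeff \<dots> k = real (n choose k) * b ^ k * a ^ (n - k)"
    using True by (simp add: coeff_sum)
  finally show ?thesis .
next
  case False
  have "degree ([:a, b:] ^ n) \<le> n"
    using degree_power_le[of "[:a, b:]" n] by (simp split: if_splits)
  then show ?thesis using False by (simp add: coeff_eq_0)
qed

text \<open>Both neighbouring binomial probabilities for \<open>L\<close> trials are multiples of one for \<open>L + 1\<close> trials,
  so the \<open>\<ell>\<^sub>1\<close>-norm becomes a mean absolute deviation, controlled by the variance.\<close>

lemma coeff_binomial_power_difference: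
  fixes p q :: real
  assumes q: "0 < p" "0 < q" "p + q = 1" and j: "j \<le> Suc L"
  shows "coeff ([:-1, 1:] * [:p, q:] ^ L) j =
    Bernstein (Suc L) j q * (real j - real (Suc L) * q) / (real (Suc L) * p * q)"
proof -
  define M where "M = real (Suc L)"
  define B where "B = Bernstein (Suc L) j q"
  have M: "M > 0" by (simp add: M_def)
  have B: "B = real (Suc L choose j) * q ^ j * p ^ (Suc L - j)"
  proof -
    have "1 - q = p" using q(3) by simp
    then show ?thesis by (simp add: B_def Bernstein_def)
  qed
  \<comment> \<open>At \<open>j = Suc L\<close> both sides vanish, the coefficient lying beyond the
    degree; otherwise this is an absorption identity for binomial coefficients.\<close>
  have same: "M * p * coeff ([:p, q:] ^ L) j = B * (M - j)"
  proof (cases "j = Suc L")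
    case True
    then show ?thesis by (simp add: coeff_binomial_power M_def)
  next
    case False
    with j have "j \<le> L" by simp
    have "real (Suc L - j) * real (Suc L choose j) = M * real (L choose j)"
      using binomial_absorb_comp[of "Suc L" j] unfolding M_def
      by (metis diff_Suc_1 of_nat_mult)
    moreover have "p ^ (Suc L - j) = p * p ^ (L - j)"
      using \<open>j \<le> L\<close> by (simp add: Suc_diff_le)
    moreover have "M - real j = real (Suc L - j)" using j by (simp add: M_def)
    ultimately show ?thesis
      unfolding B coeff_binomial_power by (simp add: mult_ac)
  qed
  have shifted: "M * q * (if j = 0 then 0 else coeff ([:p, q:] ^ L) (j - 1)) = B * j"
  proof (cases j)
    case (Suc i)
    have "real (Suc i) * real (Suc L choose Suc i) = M * real (L choose i)"
      using binomial_absorption[of i "Suc L"] unfolding M_def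
      by (metis diff_Suc_1 of_nat_mult)
    then show ?thesis
      unfolding B coeff_binomial_power Suc by (simp add: mult_ac)
  qed simp
  define x where "x = (if j = 0 then 0 else coeff ([:p, q:] ^ L) (j - 1))"
  define y where "y = coeff ([:p, q:] ^ L) j"
  \<comment> \<open>The weights \<open>p\<close> and \<open>q\<close> produce the common denominator
    \<open>M * p * q\<close>, the binomial variance; \<open>p + q = 1\<close> then collapses the
    numerator to the deviation of \<open>j\<close> from the mean \<open>M * q\<close>.\<close>
  have "(M * p * q) * (x - y) = p * (M * q * x) - q * (M * p * y)"
    by (simp add: algebra_simps)
  also have "\<dots> = p * (B * j) - q * (B * (M - j))"
    using same shifted by (simp add: x_def y_def)
  also have "\<dots> = B * (j * (p + q) - M * q)"
    by (simp add: algebra_simps)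
  also have "\<dots> = B * (j - M * q)"
    by (simp add: q(3))
  finally have "x - y = B * (j - M * q) / (M * p * q)"
    using M q by (simp add: field_simps)
  then show ?thesis
    unfolding coeff_linear_factor_mult x_def y_def M_def B_def .
qed

text \<open>The norm is the mean absolute deviation of a binomial variable with \<open>Suc L\<close>
  trials, divided by its variance \<open>V\<close>; Cauchy-Schwarz bounds that deviation by
  \<open>sqrt V\<close>, leaving \<open>1 / sqrt V\<close>.\<close>

lemma coeff_norm_binomial_power_difference:
  fixes p q :: real
  assumes q: "0 < p" "0 < q" "p + q = 1"
  shows "coeff_norm ([:-1, 1:] * [:p, q:] ^ L) \<le> 1 / sqrt (real (Suc L) * p * q)"
proof -
  define M where "M = Suc L"
  let ?P = "[:-1, 1:] * [:p, q:] ^ L"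
  let ?B = "\<lambda>j. Bernstein M j q"
  have B: "0 \<le> ?B j" for j using q by (intro Bernstein_nonneg) auto
  have Mpq: "real M * p * q > 0" using q by (simp add: M_def)
  have "degree ([:p, q:] ^ L) \<le> L"
    using degree_power_le[of "[:p, q:]" L] q by simp
  then have deg: "degree ?P < Suc M"
    using degree_mult_le[of "[:-1, 1:]" "[:p, q:] ^ L"] by (simp add: M_def del: mult_pCons_left)
  have norm: "coeff_norm ?P = (\<Sum>j\<le>M. ?B j * \<bar>real j - M * q\<bar>) / (M * p * q)"
  proof -
    have "coeff_norm ?P = (\<Sum>j\<le>M. \<bar>coeff ?P j\<bar>)"
      using coeff_norm_eq_sum_lessThan[OF deg] by (simp only: lessThan_Suc_atMost)
    also have "\<dots> = (\<Sum>j\<le>M. ?B j * \<bar>real j - M * q\<bar> / (M * p * q))"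
    proof (rule sum.cong[OF refl])
      fix j assume "j \<in> {..M}"
      then have "coeff ?P j = ?B j * (real j - M * q) / (M * p * q)"
        unfolding M_def by (intro coeff_binomial_power_difference q) simp
      then show "\<bar>coeff ?P j\<bar> = ?B j * \<bar>real j - M * q\<bar> / (M * p * q)"
        by (simp only: abs_divide abs_of_pos[OF Mpq] abs_mult[of "?B j"] abs_of_nonneg[OF B])
    qed
    finally show ?thesis by (simp only: sum_divide_distrib)
  qed
  have var: "(\<Sum>j\<le>M. ?B j * (real j - M * q)\<^sup>2) = M * p * q"
  proof -
    \<comment> \<open>The square is expanded in \<open>j (j - 1)\<close>, \<open>j\<close> and 1,
      whose Bernstein sums are known in closed form.\<close>
    have "(\<Sum>j\<le>M. ?B j * (real j - M * q)\<^sup>2) =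
        (\<Sum>j\<le>M. real j * (real j - 1) * ?B j + (1 - 2 * (M * q)) * (real j * ?B j) + (M * q)\<^sup>2 * ?B j)"
      by (intro sum.cong refl) (simp add: power2_eq_square algebra_simps)
    also have "\<dots> = real M * (real M - 1) * q\<^sup>2 + (1 - 2 * (M * q)) * (M * q) + (M * q)\<^sup>2"
      by (simp only: sum.distrib sum_kk_Bernstein sum_k_Bernstein sum_Bernstein mult_1_right
          flip: sum_distrib_left)
    also have "\<dots> = M * (1 - q) * q"
      by (simp add: power2_eq_square algebra_simps)
    also have "1 - q = p" using q(3) by simp
    finally show ?thesis .
  qed
  \<comment> \<open>Each weight is split into two square roots: the first Cauchy-Schwarz factor is
    then the total mass 1, the second the variance.\<close>
  have "(\<Sum>j\<le>M. ?B j * \<bar>real j - M * q\<bar>)\<^sup>2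
      = (\<Sum>j\<le>M. sqrt (?B j) * (sqrt (?B j) * \<bar>real j - M * q\<bar>))\<^sup>2"
    using B by (simp add: mult.assoc[symmetric])
  also have "\<dots> \<le> (\<Sum>j\<le>M. (sqrt (?B j))\<^sup>2) * (\<Sum>j\<le>M. (sqrt (?B j) * \<bar>real j - M * q\<bar>)\<^sup>2)"
    by (rule Cauchy_Schwarz_ineq_sum)
  also have "\<dots> = M * p * q"
    using B var by (simp add: power_mult_distrib)
  finally have "(\<Sum>j\<le>M. ?B j * \<bar>real j - M * q\<bar>) \<le> sqrt (M * p * q)"
    by (rule real_le_rsqrt)
  then have "coeff_norm ?P \<le> sqrt (M * p * q) / (M * p * q)"
    unfolding norm using Mpq by (intro divide_right_mono) auto
  also have "\<dots> = 1 / sqrt (M * p * q)"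
    using Mpq by (simp add: sqrt_divide_self_eq inverse_eq_divide)
  finally show ?thesis unfolding M_def .
qed

text \<open>The operator \<open>w d/dw\<close> shifts the moments by one and lowers the order of the root 1 by one.\<close>

lemma linear_power_dvd_if_moments_zero:
  fixes P :: "'a :: field_char_0 poly"
  assumes "\<And>j. j \<le> k \<Longrightarrow> (\<Sum>i\<le>degree P. of_nat i ^ j * coeff P i) = 0"
  shows "[:-1, 1:] ^ Suc k dvd P"
  using assms
proof (induction k arbitrary: P)
  case 0
  have "poly P 1 = 0" using "0.prems"[of 0] by (simp add: poly_altdef)
  then show ?case using poly_eq_0_iff_dvd[of P 1] by simp
next
  case (Suc k)
  define Q where "Q = pCons 0 (pderiv P)"
  have coeff_Q: "coeff Q i = of_nat i * coeff P i" for i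
    by (cases i) (simp_all add: Q_def coeff_pderiv)
  have "degree Q \<le> degree P"
    by (rule degree_le) (simp add: coeff_Q coeff_eq_0)
  have "(\<Sum>i\<le>degree Q. of_nat i ^ j * coeff Q i) = 0" if "j \<le> k" for j
  proof -
    have "(\<Sum>i\<le>degree Q. of_nat i ^ j * coeff Q i) = (\<Sum>i\<le>degree P. of_nat i ^ j * coeff Q i)"
      using \<open>degree Q \<le> degree P\<close> by (intro sum.mono_neutral_left) (auto simp: coeff_eq_0)
    also have "\<dots> = (\<Sum>i\<le>degree P. of_nat i ^ Suc j * coeff P i)"
      by (simp add: coeff_Q mult_ac)
    also have "\<dots> = 0" using that by (intro Suc.prems) simp
    finally show ?thesis .
  qed
  then have dvd: "[:-1, 1:] ^ Suc k dvd Q" by (rule Suc.IH)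
  have root: "poly P 1 = 0" using Suc.prems[of 0] by (simp add: poly_altdef)
  show ?case
  proof (cases "P = 0")
    case False
    \<comment> \<open>A constant with root 1 is zero, which excludes a vanishing derivative. The
      factor \<open>[:0, 1:]\<close> is nonzero at 1, so \<open>Q\<close> and
      \<open>pderiv P\<close> have the same order there, one less than that of
      \<open>P\<close>.\<close>
    have "pderiv P \<noteq> 0"
      using False root by (auto dest!: pderiv_iszero)
    moreover have Q: "Q = [:0, 1:] * pderiv P" by (simp add: Q_def)
    moreover have "order 1 Q = order 1 [:0, 1::'a:] + order 1 (pderiv P)"
      unfolding Q by (rule order_mult) (use \<open>pderiv P \<noteq> 0\<close> in simp)
    moreover have "order 1 [:0, 1::'a:] = 0" by (rule order_0I) simp
    ultimately have "order 1 Q = order 1 (pderiv P)" "Q \<noteq> 0"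
      by auto
    with dvd have "Suc k \<le> order 1 (pderiv P)"
      using order_divides[of 1 "Suc k" Q] by simp
    then have "Suc (Suc k) \<le> order 1 P"
      using order_pderiv[OF False root] by simp
    then show ?thesis using order_divides[of 1 "Suc (Suc k)" P] by simp
  qed simp
qed

subsection \<open>Means of traces of PTE strings\<close>

definition string_poly :: "bool list \<Rightarrow> real poly" where
  "string_poly u = Poly (map of_bool u)"

lemma string_poly_Cons: "string_poly (b # u) = pCons (of_bool b) (string_poly u)"
  by (simp add: string_poly_def)

lemma string_poly_zeros_append: "string_poly (zeros l @ u) = [:0, 1:] ^ l * string_poly u"
  by (induction l) (simp_all add: zeros_def string_poly_Cons mult.assoc)

text \<open>A deleted first bit leaves the means of the rest alone, a kept one shifts them. With
  \<open>q = 1 - p\<close> the generating polynomial \<open>G\<close> satisfies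
  \<open>G (b # u) = q b + (p + q z) G u\<close>, the Horner recursion of the composition.\<close>

lemma mean_bit_deletion_trace:
  assumes "0 \<le> p" "p \<le> 1"
  shows "mean_bit (deletion_trace p u) j =
    coeff (smult (1 - p) (pcompose (string_poly u) [:p, 1 - p:])) j"
proof (induction u arbitrary: j)
  case Nil
  show ?case by (simp add: string_poly_def mean_bit_def)
next
  case (Cons b u)
  have "mean_bit (deletion_trace p (b # u)) j =
      p * mean_bit (deletion_trace p u) j + (1 - p) * mean_bit (map_pmf (Cons b) (deletion_trace p u)) j"
    using assms by (simp add: mean_bit_bind)
  then show ?case
    by (cases j) (simp_all add: Cons.IH string_poly_Cons pcompose_pCons algebra_simps)
qed

lemma coeff_string_poly_indicator:
  "A \<subseteq> {..n} \<Longrightarrow> coeff (string_poly (indicator_string n A)) i = of_bool (i \<in> A)"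
  by (auto simp: string_poly_def indicator_string_def coeff_Poly_eq nth_default_def
      simp del: upt_Suc)

text \<open>The decay comes from the \<open>m\<close> blocks \<open>F\<close>. The leftover power
  and the composition with \<open>[:p, q:]\<close> do not increase the norm, while recovering
  \<open>R\<close> by \<open>m\<close> divisions costs \<open>n ^ m\<close>. Since partial sums
  never exceed the norm, \<open>N\<close> is arbitrary.\<close>

lemma sum_abs_mean_difference_le:
  fixes p q :: real and x y :: "bool list"
  assumes p: "0 < p" "0 < q" "p + q = 1" and "0 < m" "0 < l"
    and R: "string_poly x - string_poly y = [:-1, 1:] ^ m * R"
    and deg: "degree (string_poly x - string_poly y) \<le> n"
  shows "(\<Sum>j<N. \<bar>mean_bit (deletion_trace p (zeros l @ x)) j
      - mean_bit (deletion_trace p (zeros l @ y)) j\<bar>)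
    \<le> (real n * sqrt (real m / (real l * p * q))) ^ m
      * coeff_norm (string_poly x - string_poly y)"
proof -
  have q: "1 - p = q" using p by simp
  define P where "P = string_poly x - string_poly y"
  define L where "L = l div m"
  define F where "F = [:-1, 1:] * [:p, q:] ^ L"
  define c where "c = sqrt (real m / (real l * p * q))"
  have "mean_bit (deletion_trace p (zeros l @ x)) j - mean_bit (deletion_trace p (zeros l @ y)) j
      = coeff (smult q (pcompose ([:0, 1:] ^ l * P) [:p, q:])) j" for j
    using p by (simp add: mean_bit_deletion_trace q string_poly_zeros_append P_def
        right_diff_distrib pcompose_diff)
  then have "(\<Sum>j<N. \<bar>mean_bit (deletion_trace p (zeros l @ x)) j
      - mean_bit (deletion_trace p (zeros l @ y)) j\<bar>)
      \<le> coeff_norm (smult q (pcompose ([:0, 1:] ^ l * P) [:p, q:]))"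
    by (simp only: sum_abs_coeff_le_coeff_norm)
  also have "pcompose ([:0, 1:] ^ l * P) [:p, q:]
      = smult (q ^ m) (F ^ m * ([:p, q:] ^ (l mod m) * pcompose R [:p, q:]))"
  proof -
    have lin: "pcompose [:-1, 1:] [:p, q:] = smult q [:-1, 1:]"
      using q by (simp add: pcompose_pCons)
    have power: "pcompose (S ^ k) [:p, q:] = pcompose S [:p, q:] ^ k" for S :: "real poly" and k
      by (induction k) (simp_all add: pcompose_mult pcompose_1)
    have "pcompose ([:0, 1:] ^ l * P) [:p, q:]
        = [:p, q:] ^ l * (smult q [:-1, 1:]) ^ m * pcompose R [:p, q:]"
      unfolding P_def R pcompose_mult power lin by (simp add: pcompose_pCons)
    also have "[:p, q:] ^ l = ([:p, q:] ^ L) ^ m * [:p, q:] ^ (l mod m)"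
      by (simp add: L_def flip: power_mult power_add)
    finally show ?thesis
      by (simp only: F_def power_mult_distrib smult_power mult_smult_left mult_smult_right mult_ac)
  qed
  also have "coeff_norm (smult q (smult (q ^ m) (F ^ m * ([:p, q:] ^ (l mod m) * pcompose R [:p, q:]))))
      \<le> 1 * coeff_norm (F ^ m * ([:p, q:] ^ (l mod m) * pcompose R [:p, q:]))"
  proof -
    have "q * q ^ m \<le> 1"
      using p power_le_one[of q "Suc m"] by simp
    then show ?thesis
      using p by (auto simp: abs_mult mult.assoc[symmetric] intro!: mult_left_le_one_le coeff_norm_nonneg)
  qed
  also have "coeff_norm (F ^ m * ([:p, q:] ^ (l mod m) * pcompose R [:p, q:]))
      \<le> coeff_norm F ^ m * (1 * coeff_norm R)"
  proof -
    have pq: "coeff_norm [:p, q:] = 1" using p by simp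
    have "coeff_norm ([:p, q:] ^ (l mod m)) \<le> 1"
      using coeff_norm_power[of "[:p, q:]" "l mod m"] by (simp only: pq power_one)
    then have "coeff_norm ([:p, q:] ^ (l mod m) * pcompose R [:p, q:]) \<le> 1 * coeff_norm R"
      using coeff_norm_pcompose[of "[:p, q:]" R] pq
      by (intro order_trans[OF coeff_norm_mult] mult_mono coeff_norm_nonneg) auto
    with coeff_norm_power[of F m]
    have "coeff_norm (F ^ m) * coeff_norm ([:p, q:] ^ (l mod m) * pcompose R [:p, q:])
        \<le> coeff_norm F ^ m * (1 * coeff_norm R)"
      by (rule mult_mono) (simp_all add: coeff_norm_nonneg)
    with coeff_norm_mult show ?thesis by (rule order_trans)
  qed
  also have "\<dots> \<le> c ^ m * (1 * (real n ^ m * coeff_norm P))"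
  proof (intro mult_mono power_mono)
    \<comment> \<open>Rounding is harmless: \<open>L = l div m\<close> may fall below
      \<open>l / m\<close>, but the smoothing bound involves \<open>Suc L\<close>, which does
      not.\<close>
    have "real l \<le> real m * real (Suc L)"
    proof -
      have "l = m * L + l mod m" by (simp add: L_def)
      also have "\<dots> \<le> m * Suc L"
        using mod_less_divisor[OF \<open>0 < m\<close>, of l] by (simp add: less_imp_le)
      finally show ?thesis by (metis of_nat_le_iff of_nat_mult)
    qed
    then have "1 / (real (Suc L) * p * q) \<le> real m / (real l * p * q)"
      using p \<open>0 < l\<close> by (simp add: divide_simps)
    then have "1 / sqrt (real (Suc L) * p * q) \<le> c"
      unfolding c_def using real_sqrt_le_mono by (fastforce simp: real_sqrt_divide)
    then show "coeff_norm F \<le> c"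
      unfolding F_def using coeff_norm_binomial_power_difference[OF p] order_trans by blast
    show "coeff_norm R \<le> real n ^ m * coeff_norm P"
      using coeff_norm_linear_power_factor[of m R n] deg by (simp add: P_def R)
  qed (use coeff_norm_nonneg p in \<open>auto simp: c_def\<close>)
  finally show ?thesis
    by (simp add: P_def c_def power_mult_distrib mult_ac)
qed

section \<open>The difference polynomial of a PTE solution\<close>

context
  fixes k n :: nat and A B :: "nat set"
  assumes pte: "pte_solution k (int ` A) (int ` B)" and n: "n = Max (A \<union> B)"
begin

lemma pte_finite: "finite A" "finite B"
  using pte by (auto simp: pte_solution_def finite_image_iff)

lemma pte_subset: "A \<subseteq> {..n}" "B \<subseteq> {..n}"
  using pte_finite by (auto simp: n)

lemma pte_moments:
  assumes "j \<le> k"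
  shows "(\<Sum>a\<in>A. real a ^ j) = (\<Sum>b\<in>B. real b ^ j)"
proof -
  \<comment> \<open>The system starts at \<open>j = 1\<close>; the zeroth moment is the equality of
    cardinalities. Together these are \<open>k + 1\<close> conditions, hence a root of order at
    least \<open>k + 1\<close>.\<close>
  have "(\<Sum>a\<in>int ` A. a ^ j) = (\<Sum>b\<in>int ` B. b ^ j)"
    using pte assms by (cases "j = 0") (auto simp: pte_solution_def)
  then have "(\<Sum>a\<in>A. int a ^ j) = (\<Sum>b\<in>B. int b ^ j)"
    by (simp add: sum.reindex)
  then have "real_of_int (\<Sum>a\<in>A. int a ^ j) = real_of_int (\<Sum>b\<in>B. int b ^ j)"
    by simp
  then show ?thesis by simp
qed

abbreviation "pte_poly \<equiv> string_poly (indicator_string n A) - string_poly (indicator_string n B)"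

lemma coeff_pte_poly: "coeff pte_poly i = of_bool (i \<in> A) - of_bool (i \<in> B)"
  by (simp add: coeff_string_poly_indicator pte_subset)

lemma degree_pte_poly: "degree pte_poly \<le> n"
  by (rule degree_le) (use pte_subset in \<open>auto simp: coeff_pte_poly simp del: coeff_diff\<close>)

lemma coeff_norm_pte_poly: "coeff_norm pte_poly \<le> real (n + 1)"
proof -
  have "coeff_norm pte_poly = (\<Sum>i<Suc n. \<bar>coeff pte_poly i\<bar>)"
    using degree_pte_poly by (intro coeff_norm_eq_sum_lessThan) simp
  also have "\<dots> \<le> (\<Sum>i<Suc n. 1)"
    by (intro sum_mono) (simp add: coeff_pte_poly del: coeff_diff)
  finally show ?thesis by simp
qed

lemma pte_poly_nonzero: "pte_poly \<noteq> 0"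
proof -
  obtain a where "a \<in> A" "a \<notin> B" using pte by (auto simp: pte_solution_def)
  then have "coeff pte_poly a \<noteq> 0" by (simp add: coeff_pte_poly del: coeff_diff)
  then show ?thesis by (metis coeff_0)
qed

lemma linear_power_dvd_pte_poly: "[:-1, 1:] ^ Suc k dvd pte_poly"
proof (rule linear_power_dvd_if_moments_zero)
  fix j assume "j \<le> k"
  have "(\<Sum>i\<le>degree pte_poly. real i ^ j * coeff pte_poly i)
      = (\<Sum>i\<le>n. real i ^ j * coeff pte_poly i)"
    using degree_pte_poly by (intro sum.mono_neutral_left) (auto simp: coeff_eq_0 simp del: coeff_diff)
  also have "\<dots> = (\<Sum>i\<le>n. real i ^ j * of_bool (i \<in> A)) - (\<Sum>i\<le>n. real i ^ j * of_bool (i \<in> B))"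
    by (simp add: coeff_pte_poly right_diff_distrib sum_subtractf del: coeff_diff)
  also have "\<dots> = (\<Sum>i\<in>A. real i ^ j) - (\<Sum>i\<in>B. real i ^ j)"
    using pte_subset by (simp add: sum.If_cases of_bool_def if_distrib Int_absorb1 cong: if_cong)
  finally show "(\<Sum>i\<le>degree pte_poly. real i ^ j * coeff pte_poly i) = 0"
    using pte_moments[OF \<open>j \<le> k\<close>] by simp
qed

text \<open>A nonzero polynomial of degree at most \<open>n\<close> has no root of order above
  \<open>n\<close>. This bounds the number \<open>k + 1\<close> of blocks by \<open>n\<close>, and
  it forces \<open>n\<close> to be large once \<open>k\<close> is, so thresholds on \<open>k\<close>
  alone suffice.\<close>

lemma pte_degree_less: "k < n"
proof -
  have "Suc k = degree ([:-1, 1::real:] ^ Suc k)"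
    by (subst degree_power_eq) auto
  also have "\<dots> \<le> degree pte_poly"
    by (rule dvd_imp_degree_le[OF linear_power_dvd_pte_poly pte_poly_nonzero])
  finally show ?thesis using degree_pte_poly by linarith
qed

end

section \<open>Choice of constants and the asymptotic bound\<close>

theorem theorem4:
  fixes p \<epsilon> :: real
  assumes "0 < p" and "p < 1" and "0 < \<epsilon>"
  shows "\<exists>c>0. \<exists>k0::nat. \<forall>k\<ge>k0. \<forall>(A::nat set) (B::nat set) (n::nat) (l::nat).
    pte_solution k (int ` A) (int ` B) \<longrightarrow>
    n = Max (A \<union> B) \<longrightarrow>
    l = nat \<lceil>real n powr (3 + \<epsilon>)\<rceil> \<longrightarrow>
    (\<forall>(T::nat) (f :: real list \<Rightarrow> bool pmf).
       mean_based_distinguishes p T f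
         (zeros l @ indicator_string n A) (zeros l @ indicator_string n B) \<longrightarrow>
       real T \<ge> real n powr (c * real k))"
proof -
  define q where "q = 1 - p"
  have pq: "0 < p" "0 < q" "p + q = 1" using assms by (auto simp: q_def)
  define K where "K = sqrt (1 / (p * q))"
  have "K > 0" using pq by (simp add: K_def)
  \<comment> \<open>The three thresholds ensure, in turn, \<open>4 \<le> n\<close>, an exponent
    \<open>\<epsilon> / 8 * m\<close> of at least 2, and
    \<open>K \<le> n powr (\<epsilon> / 4)\<close>.\<close>
  obtain k0 :: nat where k0: "max 4 (max (16 / \<epsilon>) (K powr (4 / \<epsilon>))) \<le> real k0"
    using real_arch_simple by blast
  \<comment> \<open>The decay is \<open>n powr (- (\<epsilon> / 4 * m))\<close>; half of this
    exponent pays for the factor \<open>3 * (n + 1)\<close>, and the other half gives the constant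
    \<open>\<epsilon> / 8\<close>.\<close>
  have "real n powr (\<epsilon> / 8 * real k) \<le> real T"
    if "k0 \<le> k" and pte: "pte_solution k (int ` A) (int ` B)" and n: "n = Max (A \<union> B)"
      and l: "l = nat \<lceil>real n powr (3 + \<epsilon>)\<rceil>"
      and dist: "mean_based_distinguishes p T f
         (zeros l @ indicator_string n A) (zeros l @ indicator_string n B)"
    for k A B n l T f
  proof -
    have "k < n" by (rule pte_degree_less[OF pte n])
    have k: "4 \<le> real k" "16 / \<epsilon> \<le> real k" "K powr (4 / \<epsilon>) \<le> real k"
      using k0 \<open>k0 \<le> k\<close> by auto
    define m where "m = Suc k"
    have m: "real m \<le> real n" "k \<le> m" "0 < m" using \<open>k < n\<close> by (auto simp: m_def)
    have n4: "4 \<le> real n" using k m \<open>k < n\<close> by linarith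
    have l_ge: "real n powr (3 + \<epsilon>) \<le> real l"
      unfolding l by (rule real_nat_ceiling_ge)
    have l_pos: "0 < real l" using n4 by (intro less_le_trans[OF _ l_ge]) simp
    define x where "x = real n * sqrt (real m / (real l * p * q))"
    have x_nonneg: "0 \<le> x" using pq by (simp add: x_def)
    \<comment> \<open>With \<open>m \<le> n\<close> and \<open>l\<close> at least
      \<open>n powr (3 + \<epsilon>)\<close>, the powers of \<open>n\<close> in \<open>x\<close>
      combine to \<open>n powr (- \<epsilon> / 2)\<close>; absorbing \<open>K\<close> gives up half
      of this exponent.\<close>
    have "x \<le> real n powr (- (\<epsilon> / 4))"
    proof -
      have "real m / (real l * p * q) \<le> real n / (real n powr (3 + \<epsilon>) * p * q)"
        using m l_ge l_pos n4 pq by (intro frac_le mult_right_mono mult_pos_pos) auto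
      also have "\<dots> = real n powr (- (2 + \<epsilon>)) * (1 / (p * q))"
      proof -
        have "real n powr (3 + \<epsilon>) = real n * real n powr (2 + \<epsilon>)"
          using powr_add[of "real n" 1 "2 + \<epsilon>"] n4 by simp
        then show ?thesis using n4 unfolding powr_minus by (simp add: divide_simps)
      qed
      finally have "sqrt (real m / (real l * p * q)) \<le> sqrt (real n powr (- (2 + \<epsilon>))) * K"
        unfolding K_def real_sqrt_mult[symmetric] by (rule real_sqrt_le_mono)
      also have "sqrt (real n powr (- (2 + \<epsilon>))) = real n powr (- (1 + \<epsilon> / 2))"
        using n4 by (simp add: powr_half_sqrt[symmetric] powr_powr diff_divide_distrib)
      also have "K \<le> real n powr (\<epsilon> / 4)"
      proof -
        have "K = (K powr (4 / \<epsilon>)) powr (\<epsilon> / 4)"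
          using \<open>K > 0\<close> assms by (simp add: powr_powr)
        also have "\<dots> \<le> real n powr (\<epsilon> / 4)"
          using k \<open>k < n\<close> assms by (intro powr_mono2) auto
        finally show ?thesis .
      qed
      finally have "x \<le> real n * (real n powr (- (1 + \<epsilon> / 2)) * real n powr (\<epsilon> / 4))"
        unfolding x_def by (simp add: mult_left_mono)
      also have "\<dots> = real n powr (1 + (- (1 + \<epsilon> / 2) + \<epsilon> / 4))"
        using n4 by (simp only: powr_add) simp
      finally show ?thesis by (simp add: field_simps)
    qed
    then have x_pow: "x ^ m \<le> (real n powr (- (\<epsilon> / 4))) ^ m"
      using x_nonneg by (rule power_mono)
    obtain R where R: "pte_poly n A B = [:-1, 1:] ^ m * R"
      using linear_power_dvd_pte_poly[OF pte n] by (auto simp: m_def elim: dvdE)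
    have powr_m: "(real n powr (- (\<epsilon> / 4))) ^ m = real n powr (- (\<epsilon> / 4 * m))"
      using n4 by (simp add: powr_power mult_ac)
    \<comment> \<open>Here 3 is the reciprocal of the success gap, and \<open>n + 1\<close> bounds
      the coefficient norm of \<open>pte_poly\<close>.\<close>
    have n_le: "3 * (real n + 1) \<le> real n powr (\<epsilon> / 8 * m)"
    proof -
      have "3 * (real n + 1) \<le> 4 * real n" using n4 by simp
      also have "\<dots> \<le> real n powr 2"
        using n4 by (simp add: powr_numeral power2_eq_square)
      also have "\<dots> \<le> real n powr (\<epsilon> / 8 * m)"
      proof (rule powr_mono)
        have "16 / \<epsilon> \<le> real m" using k(2) m by linarith
        then show "2 \<le> \<epsilon> / 8 * real m" using assms by (simp add: field_simps)
      qed (use n4 in simp)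
      finally show ?thesis .
    qed
    have "1 / 3 \<le> real T * (x ^ m * coeff_norm (pte_poly n A B))"
      using mean_based_distinguishes_lower_bound[OF dist]
        sum_abs_mean_difference_le[OF pq m(3) _ R degree_pte_poly[OF pte n], of l]
        l_pos mult_left_mono[of _ _ "real T"] unfolding x_def by (smt (verit) of_nat_0_le_iff of_nat_0_less_iff)
    also have "\<dots> \<le> real T * ((real n powr (- (\<epsilon> / 4))) ^ m * real (n + 1))"
      using x_nonneg x_pow coeff_norm_pte_poly[OF pte n]
      by (intro mult_left_mono mult_mono) (auto simp: coeff_norm_nonneg)
    finally have "1 \<le> real T * (real n powr (- (\<epsilon> / 4))) ^ m * (3 * (real n + 1))"
      by (simp add: algebra_simps)
    also have "\<dots> \<le> real T * real n powr (- (\<epsilon> / 4 * m)) * real n powr (\<epsilon> / 8 * m)"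
      unfolding powr_m by (rule mult_left_mono[OF n_le]) simp
    also have "\<dots> = real T * real n powr (- (\<epsilon> / 8 * m))"
      by (simp only: mult.assoc flip: powr_add) (simp add: field_simps)
    also have "\<dots> = real T / real n powr (\<epsilon> / 8 * m)"
      by (simp only: powr_minus divide_inverse)
    finally have "real n powr (\<epsilon> / 8 * m) \<le> real T"
      using n4 by (simp add: le_divide_eq)
    moreover have "real n powr (\<epsilon> / 8 * real k) \<le> real n powr (\<epsilon> / 8 * m)"
      using m n4 assms by (intro powr_mono mult_left_mono) auto
    ultimately show ?thesis by linarith
  qed
  then show ?thesis
    using \<open>0 < \<epsilon>\<close> by (intro exI[of _ "\<epsilon> / 8"] conjI exI[of _ k0]) auto
qed

end
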